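(* Let $(T,\leq)$ and $(T_1,\leq_1)$ be linearly ordered sets, each equipped with its order topology, and let $X$ be a topological space. Let $f: T\times X\to T_1$ be a separately continuous function such that for every $x\in X$ the function $f_x: T\to T_1$, $f_x(t)=f(t,x)$, is monotonous on $T$. Then $f$ is a continuous mapping from $T\times X$, endowed with the product (Tychonoff) topology, to $T_1$.
   Context: For a linearly (totally) ordered set $(T,\leq)$, write $t<\tau$ if $t\leq\tau$ and $t\neq\tau$, and adjoin formal elements $-\infty,+\infty$ with $-\infty<t<+\infty$ for all $t\in T$ and $-\infty<+\infty$. The order topology on $T$ is the topology with base consisting of the sets $(\tau_1,\tau_2)=\{t\in T : \tau_1<t<\tau_2\}$, where $\tau_1,\tau_2\in T\cup\{-\infty,+\infty\}$, $\tau_1<\tau_2$. A mapping $f: X\times Y\to Z$ between topological spaces is separately continuous if for every $(x,y)\in X\times Y$ the mappings $f(x,\cdot): Y\to Z$ and $f(\cdot,y): X\to Z$ are continuous. A function $g: T\to T_1$ between linearly ordered sets is non-decreasing (respectively non-increasing) if $t\leq\tau$ implies $g(t)\leq_1 g(\tau)$ (respectively $g(\tau)\leq_1 g(t)$) for all $t,\tau\in T$; it is monotonous if it is non-decreasing or non-increasing. (The direction of monotonicity of $f_x$ may depend on $x$.) *)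

theory Defs
  imports Complex_Main
begin

(* The class linorder_topology is a linear order whose topology is generated by the
   open rays {..<a} and {a<..}.  The finite intersections of these (the empty one
   included) are exactly the open intervals with end points in the order extended by
   -infinity and +infinity, together with the empty set, so this is the order topology. *)

definition separately_continuous ::
    "('a::topological_space \<times> 'b::topological_space \<Rightarrow> 'c::topological_space) \<Rightarrow> bool" where
  "separately_continuous f \<longleftrightarrow>
     (\<forall>x y. continuous_on UNIV (\<lambda>v. f (x, v)) \<and> continuous_on UNIV (\<lambda>u. f (u, y)))"

definition monotonous :: "('a::linorder \<Rightarrow> 'b::linorder) \<Rightarrow> bool" where
  "monotonous g \<longleftrightarrow> mono g \<or> antimono g"

end

(* In an order topology a neighbourhood U of t0 contains points l <= t0 <= u for which the
   closed interval [l, u] is still a neighbourhood of t0 (l or u being t0 itself next to a gap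
   or at an end of the order).  By monotonicity f (t, x) lies between f (l, x) and f (u, x) for
   t in [l, u], so it stays in an open ray as soon as these two values do; and that only
   requires continuity in x at the two parameters l and u. *)
theory Submission
  imports Defs
begin

text \<open>The witness is \<open>a\<close> itself if \<open>a\<close> is the least element or has a
  gap just below it, and otherwise a point of \<open>U\<close> strictly below
  \<open>a\<close>.\<close>

lemma eventually_nhds_ge_in_open:
  fixes a :: "'a::linorder_topology"
  assumes "open U" "a \<in> U"
  obtains l where "l \<in> U" "eventually (\<lambda>t. l \<le> t) (nhds a)"
proof (cases "\<exists>y. y < a")
  case False
  then have "eventually (\<lambda>t. a \<le> t) (nhds a)"
    by (simp add: not_less)
  with that assms show thesis by blast
next
  case True
  then obtain y where "y < a" ..
  then obtain b where b: "b < a" "{b<..a} \<subseteq> U"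
    using open_left[OF assms] by blast
  show thesis
  proof (cases "\<exists>c. b < c \<and> c < a")
    case True
    \<comment> \<open>The end point \<open>b\<close> may lie outside \<open>U\<close>, so a point
      strictly between \<open>b\<close> and \<open>a\<close> replaces it.\<close>
    then obtain c where c: "b < c" "c < a" by blast
    have "eventually (\<lambda>t. c \<le> t) (nhds a)"
      using eventually_nhds_in_open[of "{c<..}" a] c by (auto elim!: eventually_mono)
    moreover have "c \<in> U"
      using b c by (auto simp: subset_iff)
    ultimately show thesis by (rule that[rotated])
  next
    case False
    \<comment> \<open>Across the gap, the open ray \<open>{b<..}\<close> contains only points that
      are at least \<open>a\<close>.\<close>
    have "eventually (\<lambda>t. a \<le> t) (nhds a)"
      using eventually_nhds_in_open[of "{b<..}" a] b False
      by (force elim!: eventually_mono simp: not_less dest: leD)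
    with that assms show thesis by blast
  qed
qed

lemma eventually_nhds_le_in_open:
  fixes a :: "'a::linorder_topology"
  assumes "open U" "a \<in> U"
  obtains u where "u \<in> U" "eventually (\<lambda>t. t \<le> u) (nhds a)"
proof (cases "\<exists>y. a < y")
  case False
  then have "eventually (\<lambda>t. t \<le> a) (nhds a)"
    by (simp add: not_less)
  with that assms show thesis by blast
next
  case True
  then obtain y where "a < y" ..
  then obtain b where b: "a < b" "{a..<b} \<subseteq> U"
    using open_right[OF assms] by blast
  show thesis
  proof (cases "\<exists>c. a < c \<and> c < b")
    case True
    then obtain c where c: "a < c" "c < b" by blast
    have "eventually (\<lambda>t. t \<le> c) (nhds a)"
      using eventually_nhds_in_open[of "{..<c}" a] c by (auto elim!: eventually_mono)
    moreover have "c \<in> U"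
      using b c by (auto simp: subset_iff)
    ultimately show thesis by (rule that[rotated])
  next
    case False
    have "eventually (\<lambda>t. t \<le> a) (nhds a)"
      using eventually_nhds_in_open[of "{..<b}" a] b False
      by (force elim!: eventually_mono simp: not_less dest: leD)
    with that assms show thesis by blast
  qed
qed

text \<open>Bounds by \<open>min\<close> and \<open>max\<close> cover both directions of
  monotonicity at once, so no case split is needed when the direction varies with
  \<open>x\<close>.\<close>

lemma monotonous_between:
  assumes "monotonous g" "l \<le> t" "t \<le> u"
  shows "min (g l) (g u) \<le> g t" "g t \<le> max (g l) (g u)"
  using assms unfolding monotonous_def
  by (simp_all add: min_le_iff_disj le_max_iff_disj mono_def antimono_def) blast+

text \<open>The hypothesis \<open>ray\<close> is order convexity of \<open>V\<close>, phrased to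
  match \<open>monotonous_between\<close>; lower and upper open rays both satisfy it, so one
  argument serves both.\<close>

lemma separately_continuous_eventually_in_ray:
  fixes f :: "'t::linorder_topology \<times> 'x::topological_space \<Rightarrow> 's::linorder_topology"
  assumes f: "separately_continuous f" "\<And>x. monotonous (\<lambda>t. f (t, x))"
    and V: "open V" "f (a, b) \<in> V"
    and ray: "\<And>p q r. p \<in> V \<Longrightarrow> q \<in> V \<Longrightarrow> min p q \<le> r \<Longrightarrow> r \<le> max p q \<Longrightarrow> r \<in> V"
  shows "eventually (\<lambda>z. f z \<in> V) (nhds (a, b))"
proof -
  have cont: "continuous_on UNIV (\<lambda>x. f (t, x))" "continuous_on UNIV (\<lambda>t. f (t, x))" for t x
    using f(1) by (auto simp: separately_continuous_def)
  let ?U = "(\<lambda>t. f (t, b)) -` V"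
  have U: "open ?U" "a \<in> ?U"
    using V cont(2) by (auto intro: open_vimage)
  from U obtain l where l: "l \<in> ?U" "eventually (\<lambda>t. l \<le> t) (nhds a)"
    by (rule eventually_nhds_ge_in_open)
  from U obtain u where u: "u \<in> ?U" "eventually (\<lambda>t. t \<le> u) (nhds a)"
    by (rule eventually_nhds_le_in_open)
  \<comment> \<open>The neighbourhood of \<open>b\<close> depends on \<open>t\<close>, which is
    harmless because only \<open>t = l\<close> and \<open>t = u\<close> are used.\<close>
  have near: "eventually (\<lambda>x. f (t, x) \<in> V) (nhds b)" if "t \<in> ?U" for t
    using eventually_nhds_in_open[OF open_vimage[OF V(1) cont(1)], of b t] that by simp
  \<comment> \<open>The condition on \<open>t\<close> does not involve \<open>x\<close> and
    conversely, so together they hold on a product neighbourhood.\<close>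
  have "eventually (\<lambda>(t, x). (l \<le> t \<and> t \<le> u) \<and> (f (l, x) \<in> V \<and> f (u, x) \<in> V))
      (nhds a \<times>\<^sub>F nhds b)"
    using eventually_prodI[OF eventually_conj[OF l(2) u(2)]
        eventually_conj[OF near[OF l(1)] near[OF u(1)]]]
    by (simp add: case_prod_unfold)
  then show ?thesis
    unfolding nhds_prod
    by (rule eventually_mono) (auto intro: ray monotonous_between[OF f(2)])
qed

theorem theorem1:
  fixes f :: "'t::linorder_topology \<times> 'x::topological_space \<Rightarrow> 's::linorder_topology"
  assumes "separately_continuous f"
    and "\<And>x. monotonous (\<lambda>t. f (t, x))"
  shows "continuous_on UNIV f"
proof -
  \<comment> \<open>Open rays form a subbase of the order topology, so it suffices that strict
    bounds on \<open>f (a, b)\<close> persist nearby.\<close>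
  have "(f \<longlongrightarrow> f (a, b)) (nhds (a, b))" for a b
  proof (rule order_tendstoI)
    fix y assume "y < f (a, b)"
    then have "eventually (\<lambda>z. f z \<in> {y<..}) (nhds (a, b))"
      by (intro separately_continuous_eventually_in_ray[OF assms])
        (simp_all, metis less_le_trans min_less_iff_conj)
    then show "eventually (\<lambda>z. y < f z) (nhds (a, b))"
      by simp
  next
    fix y assume "f (a, b) < y"
    then have "eventually (\<lambda>z. f z \<in> {..<y}) (nhds (a, b))"
      by (intro separately_continuous_eventually_in_ray[OF assms])
        (simp_all, metis le_less_trans max_less_iff_conj)
    then show "eventually (\<lambda>z. f z < y) (nhds (a, b))"
      by simp
  qed
  then have "(f \<longlongrightarrow> f z) (nhds z)" for z
    by (cases z) simp
  then have "(f \<longlongrightarrow> f z) (at z)" for z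
    by (rule tendsto_mono[rotated]) (simp add: at_within_def)
  then show ?thesis
    unfolding continuous_on_def by simp
qed

end
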